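(* Let $H$ be a complex Hilbert space, $A\in B(H)$ a normal operator with spectral measure $E_A$, and $U\subset\mathbb{C}$ an open set with $\sigma(A)\subseteq U$. Let $p_1,\dots,p_K$ be holomorphic functions on $U$ with $\sup_{\lambda\in\sigma(A)}|p_k(\lambda)|\le 1$ for each $k$, let $f:=p_K\circ\cdots\circ p_1$, and let $f^m$ be the $m$-fold composition of $f$ with itself (all these compositions being defined on a neighbourhood of $\sigma(A)$). Put $A^{(m)}:=f^m(A)$. Suppose that $\sup_m\|f^m\|_\infty<\infty$ and that there is a Borel function $\chi:\sigma(A)\to\mathbb{C}$ with $\lim_{m\to\infty}f^m(\lambda)=\chi(\lambda)$ for all $\lambda\in\sigma(A)$. Then the limit $A^{(\omega)}:=\lim_{m\to\infty}A^{(m)}$ exists in the strong operator topology, and $A^{(\omega)}=\chi(A)$. If, moreover, $\chi$ takes only the values $0$ and $1$, then $P:=\chi(A)$ is an orthogonal projection that commutes with $A$, $\mathrm{Ran}\,P=E_A(\chi^{-1}(\{1\}))H$, and $\sigma(P)=\{0,1\}$ unless $P=0$ or $P=I$.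
   Context: $\|g\|_\infty:=\sup_{\lambda\in\sigma(A)}|g(\lambda)|$. For a bounded Borel function $g$ on $\sigma(A)$, $g(A)=\int g\,dE_A$ is the Borel functional calculus of the normal operator $A$. *)

theory Defs
  imports "HOL-Analysis.Analysis"
begin

text \<open>The inner product is linear in its first argument. Positive definiteness is contained in
  \<open>cinner_self\<close>, which also says that the norm is the one induced by the inner product;
  \<open>scaleC_of_real\<close> contains the unit law (take \<open>r = 1\<close>).\<close>

class complex_inner = real_normed_vector +
  fixes scaleC :: "complex \<Rightarrow> 'a \<Rightarrow> 'a" (infixr "*\<^sub>C" 75)
    and cinner :: "'a \<Rightarrow> 'a \<Rightarrow> complex"
  assumes scaleC_add_right: "a *\<^sub>C (x + y) = a *\<^sub>C x + a *\<^sub>C y"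
    and scaleC_add_left: "(a + b) *\<^sub>C x = a *\<^sub>C x + b *\<^sub>C x"
    and scaleC_scaleC: "a *\<^sub>C (b *\<^sub>C x) = (a * b) *\<^sub>C x"
    and scaleC_of_real: "complex_of_real r *\<^sub>C x = r *\<^sub>R x"
    and cinner_commute: "cinner x y = cnj (cinner y x)"
    and cinner_add_left: "cinner (x + y) z = cinner x z + cinner y z"
    and cinner_scaleC_left: "cinner (a *\<^sub>C x) y = a * cinner x y"
    and cinner_self: "cinner x x = complex_of_real ((norm x)\<^sup>2)"

class chilbert_space = complex_inner + complete_space

instantiation complex :: chilbert_space
begin

definition scaleC_complex :: "complex \<Rightarrow> complex \<Rightarrow> complex" where
  "scaleC_complex a x = a * x"

definition cinner_complex :: "complex \<Rightarrow> complex \<Rightarrow> complex" where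
  "cinner_complex x y = x * cnj y"

instance
proof
  fix x :: complex
  show "cinner x x = complex_of_real ((norm x)\<^sup>2)"
    unfolding cinner_complex_def by (rule complex_norm_square[symmetric])
qed (simp_all add: scaleC_complex_def cinner_complex_def ring_distribs scaleR_conv_of_real)

end

text \<open>The elements of \<open>B(H)\<close> are the members of the library type of bounded real-linear maps that
  satisfy \<open>clinear_op\<close>.\<close>

definition clinear_op :: "('a::complex_inner \<Rightarrow>\<^sub>L 'a) \<Rightarrow> bool" where
  "clinear_op T \<longleftrightarrow> (\<forall>c x. T (c *\<^sub>C x) = c *\<^sub>C T x)"

definition cadjoint :: "('a::complex_inner \<Rightarrow>\<^sub>L 'a) \<Rightarrow> ('a \<Rightarrow>\<^sub>L 'a)" where
  "cadjoint T = (THE S :: 'a \<Rightarrow>\<^sub>L 'a. \<forall>x y. cinner (T x) y = cinner x (S y))"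

definition normal_op :: "('a::complex_inner \<Rightarrow>\<^sub>L 'a) \<Rightarrow> bool" where
  "normal_op T \<longleftrightarrow> clinear_op T \<and> T o\<^sub>L cadjoint T = cadjoint T o\<^sub>L T"

definition orth_projection :: "('a::complex_inner \<Rightarrow>\<^sub>L 'a) \<Rightarrow> bool" where
  "orth_projection P \<longleftrightarrow> clinear_op P \<and> P o\<^sub>L P = P \<and> cadjoint P = P"

definition spectrum :: "('a::complex_inner \<Rightarrow>\<^sub>L 'a) \<Rightarrow> complex set" where
  "spectrum T = {z. \<not> (\<exists>S. clinear_op S \<and>
      (\<forall>x. S (T x - z *\<^sub>C x) = x) \<and> (\<forall>x. T (S x) - z *\<^sub>C S x = x))}"

definition projection_valued_measure ::
    "complex measure \<Rightarrow> (complex set \<Rightarrow> ('a::complex_inner \<Rightarrow>\<^sub>L 'a)) \<Rightarrow> bool" where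
  "projection_valued_measure M E \<longleftrightarrow>
     (\<forall>B\<in>sets M. orth_projection (E B)) \<and>
     E {} = 0 \<and> E (space M) = id_blinfun \<and>
     (\<forall>B\<in>sets M. \<forall>C\<in>sets M. E (B \<inter> C) = E B o\<^sub>L E C) \<and>
     (\<forall>F::nat \<Rightarrow> complex set. range F \<subseteq> sets M \<longrightarrow> disjoint_family F \<longrightarrow>
        (\<forall>x. (\<lambda>n. E (F n) x) sums E (\<Union>n. F n) x))"

text \<open>The finite positive measure mapping \<open>B\<close> to \<open>\<langle>E(B)x, x\<rangle>\<close>.\<close>

definition scalar_measure ::
    "complex measure \<Rightarrow> (complex set \<Rightarrow> ('a::complex_inner \<Rightarrow>\<^sub>L 'a)) \<Rightarrow> 'a \<Rightarrow> complex measure" where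
  "scalar_measure M E x =
     measure_of (space M) (sets M) (\<lambda>B. ennreal (Re (cinner (E B x) x)))"

text \<open>The integral of a bounded measurable function \<open>g\<close> against \<open>E\<close> is the bounded operator \<open>T\<close>
  with \<open>\<langle>Tx, x\<rangle> = \<integral> g d\<langle>E x, x\<rangle>\<close> for all \<open>x\<close>; by polarization the diagonal values determine \<open>T\<close>,
  see \<open>has_spectral_integral_unique\<close>.\<close>

definition has_spectral_integral ::
    "complex measure \<Rightarrow> (complex set \<Rightarrow> ('a::complex_inner \<Rightarrow>\<^sub>L 'a)) \<Rightarrow> (complex \<Rightarrow> complex) \<Rightarrow>
     ('a \<Rightarrow>\<^sub>L 'a) \<Rightarrow> bool" where
  "has_spectral_integral M E g T \<longleftrightarrow>
     clinear_op T \<and> (\<forall>x. cinner (T x) x = (\<integral>z. g z \<partial>scalar_measure M E x))"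

definition spectral_integral ::
    "complex measure \<Rightarrow> (complex set \<Rightarrow> ('a::complex_inner \<Rightarrow>\<^sub>L 'a)) \<Rightarrow> (complex \<Rightarrow> complex) \<Rightarrow>
     ('a \<Rightarrow>\<^sub>L 'a)" where
  "spectral_integral M E g = (THE T. has_spectral_integral M E g T)"

lemma clinear_op_eqI:
  fixes S T :: "'a::complex_inner \<Rightarrow>\<^sub>L 'a"
  assumes S: "clinear_op S" and T: "clinear_op T"
    and eq: "\<And>x. cinner (S x) x = cinner (T x) x"
  shows "S = T"
proof -
  define D where "D = S - T"
  have neg: "- v = (-1) *\<^sub>C v" for v :: 'a
    using scaleC_of_real[of "-1" v] by simp
  have cl: "D (c *\<^sub>C x) = c *\<^sub>C D x" for c x
  proof -
    have "c *\<^sub>C (- v) = - (c *\<^sub>C v)" for v :: 'a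
      by (simp only: neg scaleC_scaleC) simp
    then have "c *\<^sub>C (u - v) = c *\<^sub>C u - c *\<^sub>C v" for u v :: 'a
      using scaleC_add_right[of c u "- v"] by simp
    then show ?thesis
      using S T by (simp add: D_def clinear_op_def blinfun.diff_left)
  qed
  have cdiff: "cinner (u - v) w = cinner u w - cinner v w" for u v w :: 'a
    using cinner_add_left[of "u - v" v w] by simp
  have radd: "cinner u (v + w) = cinner u v + cinner u w" for u v w :: 'a
    by (metis cinner_add_left cinner_commute complex_cnj_add)
  have rscale: "cinner u (c *\<^sub>C w) = cnj c * cinner u w" for u w :: 'a and c
    by (metis cinner_commute cinner_scaleC_left complex_cnj_mult)
  have diag: "cinner (D x) x = 0" for x
    using eq[of x] by (simp add: D_def blinfun.diff_left cdiff)
  have "D x = 0" for x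
  proof -
    define y where "y = D x"
    have 1: "cinner (D x) y + cinner (D y) x = 0"
      using diag[of "x + y"] diag[of x] diag[of y]
      by (simp add: blinfun.add_right cinner_add_left radd add.commute)
    have 2: "- \<i> * cinner (D x) y + \<i> * cinner (D y) x = 0"
      using diag[of "x + \<i> *\<^sub>C y"] diag[of x] diag[of y]
      by (simp add: blinfun.add_right cinner_add_left radd cl cinner_scaleC_left rscale add.commute)
    have "\<i> * (cinner (D y) x - cinner (D x) y) = 0"
      using 2 by (simp add: right_diff_distrib)
    then have "cinner (D x) y = cinner (D y) x" by simp
    with 1 have "cinner (D x) y = 0" by simp
    then show ?thesis
      using cinner_self[of y] by (simp add: y_def)
  qed
  then show ?thesis
    by (intro blinfun_eqI) (simp add: D_def blinfun.diff_left)
qed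

lemma has_spectral_integral_unique:
  assumes "has_spectral_integral M E g S" "has_spectral_integral M E g T"
  shows "S = T"
  using assms by (intro clinear_op_eqI) (auto simp: has_spectral_integral_def)

definition spectral_space :: "('a::complex_inner \<Rightarrow>\<^sub>L 'a) \<Rightarrow> complex measure" where
  "spectral_space A = restrict_space borel (spectrum A)"

definition is_spectral_measure ::
    "('a::complex_inner \<Rightarrow>\<^sub>L 'a) \<Rightarrow> (complex set \<Rightarrow> ('a \<Rightarrow>\<^sub>L 'a)) \<Rightarrow> bool" where
  "is_spectral_measure A E \<longleftrightarrow>
     projection_valued_measure (spectral_space A) E \<and>
     has_spectral_integral (spectral_space A) E (\<lambda>z. z) A"

text \<open>\<open>g(A)\<close>, for \<open>A\<close> with spectral measure \<open>E\<close>.\<close>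

definition borel_calculus ::
    "('a::complex_inner \<Rightarrow>\<^sub>L 'a) \<Rightarrow> (complex set \<Rightarrow> ('a \<Rightarrow>\<^sub>L 'a)) \<Rightarrow> (complex \<Rightarrow> complex) \<Rightarrow>
     ('a \<Rightarrow>\<^sub>L 'a)" where
  "borel_calculus A E g = spectral_integral (spectral_space A) E g"

definition sup_norm_on :: "complex set \<Rightarrow> (complex \<Rightarrow> complex) \<Rightarrow> ennreal" where
  "sup_norm_on S g = (SUP z\<in>S. ennreal (cmod (g z)))"

text \<open>\<open>comp_chain p k\<close> is \<open>p\<^sub>k \<circ> \<dots> \<circ> p\<^sub>1\<close>.\<close>

primrec comp_chain :: "(nat \<Rightarrow> complex \<Rightarrow> complex) \<Rightarrow> nat \<Rightarrow> complex \<Rightarrow> complex" where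
  "comp_chain p 0 = id"
| "comp_chain p (Suc k) = p (Suc k) \<circ> comp_chain p k"

text \<open>For partial functions \<open>p\<^sub>1, \<dots>, p\<^sub>K\<close> with domain \<open>U\<close>, the \<open>m\<close>-fold iterate of
  \<open>p\<^sub>K \<circ> \<dots> \<circ> p\<^sub>1\<close> is defined at \<open>z\<close>: every argument handed to some \<open>p\<^bsub>k+1\<^esub>\<close> along the way
  lies in \<open>U\<close>.\<close>

definition iterate_defined_at ::
    "(nat \<Rightarrow> complex \<Rightarrow> complex) \<Rightarrow> nat \<Rightarrow> complex set \<Rightarrow> nat \<Rightarrow> complex \<Rightarrow> bool" where
  "iterate_defined_at p K U m z \<longleftrightarrow>
     (\<forall>j<m. \<forall>k<K. comp_chain p k ((comp_chain p K ^^ j) z) \<in> U)"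

end

theory Submission
  imports Defs
begin

text \<open>Every operator \<open>g(A)\<close> satisfies \<open>\<parallel>g(A) x\<parallel>\<^sup>2 = \<integral> \<bar>g\<bar>\<^sup>2 d\<langle>E x, x\<rangle>\<close>. This isometry, first checked on simple
  functions by orthogonality, yields the existence of \<open>g(A)\<close> for bounded Borel \<open>g\<close>; applied to
  \<open>f\<^sup>m - \<chi>\<close> it turns dominated convergence into strong convergence. If \<open>\<chi>\<close> only takes the values 0 and 1,
  it is the indicator function of \<open>B = \<chi>\<^sup>-\<^sup>1(1)\<close> and \<open>\<chi>(A) = E(B)\<close>.

  Since \<open>cadjoint\<close> is a definite description, the self-adjointness of \<open>E(B)\<close> is only available once
  adjoints are known to exist, hence the Riesz representation theorem. Boundedness of the spectrum
  makes the identity function integrable, which is needed for \<open>A\<close> to commute with \<open>E(B)\<close>.\<close>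

section \<open>Inner product geometry: Cauchy-Schwarz, continuity and Pythagoras\<close>

lemma cinner_add_right: "cinner u (v + w) = cinner u v + cinner u (w::'a::complex_inner)"
  by (metis cinner_add_left cinner_commute complex_cnj_add)

lemma cinner_scaleC_right: "cinner u (c *\<^sub>C w) = cnj c * cinner u (w::'a::complex_inner)"
  by (metis cinner_commute cinner_scaleC_left complex_cnj_mult)

lemma Re_cinner_self: "Re (cinner x x) = (norm (x::'a::complex_inner))\<^sup>2"
  by (simp only: cinner_self Re_complex_of_real)

text \<open>The axioms give this directly only for real scalars. For complex \<open>c\<close> its
  square comes from expanding \<open>cinner (c *\<^sub>C x) (c *\<^sub>C x)\<close>.\<close>

lemma norm_scaleC: "norm (c *\<^sub>C x) = cmod c * norm (x::'a::complex_inner)"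
proof -
  have "complex_of_real ((norm (c *\<^sub>C x))\<^sup>2) = c * cnj c * cinner x x"
    by (simp only: cinner_self[symmetric] cinner_scaleC_left cinner_scaleC_right mult_ac)
  also have "\<dots> = complex_of_real ((cmod c * norm x)\<^sup>2)"
    by (simp only: complex_norm_square[symmetric] power_mult_distrib cinner_self of_real_mult)
  finally have "(norm (c *\<^sub>C x))\<^sup>2 = (cmod c * norm x)\<^sup>2"
    using of_real_eq_iff by blast
  then show ?thesis
    by (simp add: power2_eq_iff_nonneg)
qed

lemma scaleC_one: "1 *\<^sub>C x = (x::'a::complex_inner)"
  using scaleC_of_real[of 1 x] by simp

lemma bounded_bilinear_scaleC: "bounded_bilinear (scaleC :: complex \<Rightarrow> 'a \<Rightarrow> 'a::complex_inner)"
proof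
  show "\<exists>K. \<forall>(a::complex) (b::'a). norm (a *\<^sub>C b) \<le> norm a * norm b * K"
    by (rule exI[of _ 1]) (simp add: norm_scaleC)
  show "(r *\<^sub>R a) *\<^sub>C b = r *\<^sub>R (a *\<^sub>C b)" "a *\<^sub>C (r *\<^sub>R b) = r *\<^sub>R (a *\<^sub>C b)"
    for r a and b :: 'a
    by (simp_all only: scaleR_conv_of_real[of r a] scaleC_of_real[of r b, symmetric]
        scaleC_of_real[of r "a *\<^sub>C b", symmetric] scaleC_scaleC mult.commute)
qed (simp_all add: scaleC_add_left scaleC_add_right)

interpretation scaleC: bounded_bilinear "scaleC :: complex \<Rightarrow> 'a \<Rightarrow> 'a::complex_inner"
  by (rule bounded_bilinear_scaleC)

lemma norm_add_sq:
  "(norm (x + y))\<^sup>2 = (norm x)\<^sup>2 + 2 * Re (cinner x y) + (norm (y::'a::complex_inner))\<^sup>2"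
proof -
  have "(norm (x + y))\<^sup>2 = Re (cinner (x + y) (x + y))"
    by (simp only: Re_cinner_self)
  also have "\<dots> = (norm x)\<^sup>2 + Re (cinner x y) + Re (cinner y x) + (norm y)\<^sup>2"
    by (simp add: cinner_add_left cinner_add_right Re_cinner_self)
  also have "Re (cinner y x) = Re (cinner x y)"
    by (subst cinner_commute) simp
  finally show ?thesis by simp
qed

text \<open>Squaring the triangle inequality of the norm and expanding both sides leaves exactly
  this form of Cauchy-Schwarz.\<close>

lemma Re_cinner_le: "Re (cinner x y) \<le> norm x * norm (y::'a::complex_inner)"
proof -
  have "(norm (x + y))\<^sup>2 \<le> (norm x + norm y)\<^sup>2"
    by (simp add: norm_triangle_ineq power_mono)
  then show ?thesis
    by (simp add: norm_add_sq power2_sum)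
qed

text \<open>Multiplying \<open>x\<close> by 1, -1, \<i> and -\<i> transfers the bound on the real
  part to the absolute values of the real and the imaginary part. Adding the two gives the factor 2,
  which suffices for continuity of the inner product.\<close>

lemma cmod_cinner_le: "cmod (cinner x y) \<le> 2 * (norm x * norm (y::'a::complex_inner))"
proof -
  have *: "Re (c * cinner x y) \<le> norm x * norm y" if "cmod c = 1" for c
    using Re_cinner_le[of "c *\<^sub>C x" y] that by (simp add: cinner_scaleC_left norm_scaleC)
  have "\<bar>Re (cinner x y)\<bar> \<le> norm x * norm y" "\<bar>Im (cinner x y)\<bar> \<le> norm x * norm y"
    using *[of 1] *[of "-1"] *[of \<i>] *[of "-\<i>"] by simp_all
  then show ?thesis
    using cmod_le[of "cinner x y"] by linarith
qed

lemma bounded_bilinear_cinner: "bounded_bilinear (cinner :: 'a \<Rightarrow> 'a::complex_inner \<Rightarrow> complex)"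
proof
  show "\<exists>K. \<forall>(a::'a) b. norm (cinner a b) \<le> norm a * norm b * K"
    by (rule exI[of _ 2]) (simp add: cmod_cinner_le mult.commute[of _ 2])
  show "cinner (r *\<^sub>R a) b = r *\<^sub>R cinner a b" "cinner a (r *\<^sub>R b) = r *\<^sub>R cinner a b"
    for r and a b :: 'a
    by (simp_all add: scaleC_of_real[of r a, symmetric] scaleC_of_real[of r b, symmetric]
        cinner_scaleC_left cinner_scaleC_right scaleR_conv_of_real)
qed (simp_all add: cinner_add_left cinner_add_right)

interpretation cinner: bounded_bilinear "cinner :: 'a \<Rightarrow> 'a::complex_inner \<Rightarrow> complex"
  by (rule bounded_bilinear_cinner)

lemma cinner_eq_rightI:
  fixes u v :: "'a::complex_inner"
  assumes "\<And>x. cinner x u = cinner x v"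
  shows "u = v"
proof -
  have "cinner (u - v) (u - v) = 0"
    using assms[of "u - v"] by (simp add: cinner.diff_right)
  then show ?thesis by (simp add: cinner_self)
qed

text \<open>Pythagoras: it makes the integral of a simple function, a sum over disjoint level sets,
  an isometry.\<close>

lemma norm_sum_orthogonal_sq:
  fixes v :: "'i \<Rightarrow> 'b::complex_inner"
  assumes "finite I" "\<And>i j. i \<in> I \<Longrightarrow> j \<in> I \<Longrightarrow> i \<noteq> j \<Longrightarrow> cinner (v i) (v j) = 0"
  shows "(norm (\<Sum>i\<in>I. v i))\<^sup>2 = (\<Sum>i\<in>I. (norm (v i))\<^sup>2)"
  using assms
proof (induction I rule: finite_induct)
  case (insert i I)
  then have "cinner (v i) (\<Sum>j\<in>I. v j) = (\<Sum>j\<in>I. 0)"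
    unfolding cinner.sum_right by (intro sum.cong) auto
  with insert show ?case
    by (simp add: norm_add_sq)
qed simp

section \<open>Riesz representation and adjoints\<close>

lemma parallelogram:
  "(norm (x - y))\<^sup>2 = 2 * (norm x)\<^sup>2 + 2 * (norm y)\<^sup>2 - (norm (x + (y::'a::complex_inner)))\<^sup>2"
  using norm_add_sq[of x y] norm_add_sq[of x "- y"] by (simp add: cinner.minus_right)

text \<open>The representing vector is the minimiser of \<open>\<parallel>x\<parallel>\<^sup>2 - 2 Re F x\<close>; by the parallelogram law
  every minimising sequence is Cauchy.\<close>

lemma riesz_representation:
  fixes F :: "'a::chilbert_space \<Rightarrow> complex"
  assumes F: "bounded_linear F" and FC: "\<And>c x. F (c *\<^sub>C x) = c * F x"
  shows "\<exists>w. \<forall>x. F x = cinner x w"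
proof -
  interpret F: bounded_linear F by fact
  define J where "J = (\<lambda>x. (norm x)\<^sup>2 - 2 * Re (F x))"
  obtain C where C: "\<And>x. norm (F x) \<le> norm x * C"
    using F.bounded by blast
  \<comment> \<open>Completing the square in \<open>norm x - C\<close> bounds \<open>J\<close> from
    below, so the infimum \<open>d\<close> is meaningful.\<close>
  have J_ge: "- C\<^sup>2 \<le> J x" for x
  proof -
    have "Re (F x) \<le> norm x * C"
      using C[of x] complex_Re_le_cmod[of "F x"] by linarith
    moreover have "0 \<le> (norm x - C)\<^sup>2" by simp
    ultimately show ?thesis
      by (simp add: J_def power2_diff)
  qed
  define d where "d = Inf (range J)"
  have bdd: "bdd_below (range J)"
    using J_ge by (intro bdd_belowI2)
  have d_le: "d \<le> J x" for x
    unfolding d_def by (rule cInf_lower[OF _ bdd]) simp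
  have "\<exists>x. J x < d + 1 / real (Suc n)" for n
    using cInf_lessD[of "range J" "d + 1 / real (Suc n)"] unfolding d_def by auto
  then obtain s where s: "\<And>n. J (s n) < d + 1 / real (Suc n)"
    by metis
  \<comment> \<open>The midpoint of \<open>x\<close> and \<open>y\<close> has \<open>J\<close>-value
    at least \<open>d\<close>; put into the parallelogram law, this bounds the distance of two
    near-minimisers.\<close>
  have gap: "(norm (x - y))\<^sup>2 \<le> 2 * (J x - d) + 2 * (J y - d)" for x y
  proof -
    have "J ((1/2) *\<^sub>R (x + y)) = (norm (x + y))\<^sup>2 / 4 - (Re (F x) + Re (F y))"
      unfolding J_def F.scaleR F.add norm_scaleR power_mult_distrib
      by (simp add: power_divide add_divide_distrib)
    with d_le[of "(1/2) *\<^sub>R (x + y)"] parallelogram[of x y] show ?thesis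
      by (simp add: J_def)
  qed
  have "Cauchy s"
  proof (rule metric_CauchyI)
    fix e :: real assume e: "e > 0"
    then obtain N where N: "inverse (real (Suc N)) < e\<^sup>2 / 4"
      using reals_Archimedean[of "e\<^sup>2 / 4"] by auto
    have "dist (s m) (s n) < e" if "m \<ge> N" "n \<ge> N" for m n
    proof -
      have close: "J (s k) < d + e\<^sup>2 / 4" if "k \<ge> N" for k
      proof -
        have "1 / real (Suc k) \<le> inverse (real (Suc N))"
          using that by (simp add: field_simps)
        then have "d + 1 / real (Suc k) \<le> d + e\<^sup>2 / 4"
          using N by (intro add_left_mono) (rule order.trans, assumption, rule less_imp_le)
        then show ?thesis
          using s[of k] by (rule order_less_le_trans[rotated])
      qed
      have "(norm (s m - s n))\<^sup>2 < e\<^sup>2"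
        using gap[of "s m" "s n"] close[OF that(1)] close[OF that(2)] by simp
      then show ?thesis
        using e by (simp add: dist_norm power2_less_imp_less)
    qed
    then show "\<exists>M. \<forall>m\<ge>M. \<forall>n\<ge>M. dist (s m) (s n) < e" by blast
  qed
  then obtain w where w: "s \<longlonglongrightarrow> w"
    using Cauchy_convergent convergent_def by blast
  have "(\<lambda>n. J (s n)) \<longlonglongrightarrow> J w"
    unfolding J_def by (intro tendsto_intros F.tendsto w)
  moreover have "(\<lambda>n. d + 1 / real (Suc n)) \<longlonglongrightarrow> d + 0"
    using LIMSEQ_inverse_real_of_nat
    by (intro tendsto_intros) (simp add: divide_inverse)
  ultimately have "J w \<le> d"
    using s by (auto intro: LIMSEQ_le less_imp_le)
  then have min: "J w \<le> J x" for x
    using d_le[of x] by linarith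
  have Re_eq: "Re (F h) = Re (cinner h w)" for h
  proof -
    \<comment> \<open>\<open>2 * b\<close> is the derivative of \<open>J\<close> at \<open>w\<close>
      in direction \<open>h\<close>; minimality forces it to vanish.\<close>
    define b where "b = Re (cinner w h) - Re (F h)"
    have quad: "0 \<le> t\<^sup>2 * (norm h)\<^sup>2 + 2 * t * b" for t
    proof -
      have "J (w + t *\<^sub>R h) = J w + t\<^sup>2 * (norm h)\<^sup>2 + 2 * t * b"
        by (simp add: J_def b_def norm_add_sq F.add F.scaleR cinner.scaleR_right
            power_mult_distrib algebra_simps)
      then show ?thesis using min[of "w + t *\<^sub>R h"] by simp
    qed
    \<comment> \<open>At \<open>t = - b * c\<close> the quadratic equals
      \<open>b\<^sup>2 * (c * (c * (norm h)\<^sup>2 - 2))\<close>, which is negative unless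
      \<open>b = 0\<close>. The added 1 keeps the denominator positive when
      \<open>h = 0\<close>.\<close>
    define c where "c = 1 / ((norm h)\<^sup>2 + 1)"
    have pos: "(norm h)\<^sup>2 + 1 > 0"
      by (smt (verit) zero_le_power2)
    then have "c > 0" "c * (norm h)\<^sup>2 < 2"
      by (simp_all add: c_def divide_less_eq)
    moreover have "0 \<le> b\<^sup>2 * (c * (c * (norm h)\<^sup>2 - 2))"
      using quad[of "- b * c"] by (simp add: power2_eq_square algebra_simps)
    ultimately have "b = 0"
      by (auto simp: zero_le_mult_iff)
    then have "Re (F h) = Re (cinner w h)"
      by (simp add: b_def)
    then show ?thesis
      by (subst cinner_commute) simp
  qed
  have "F x = cinner x w" for x
  proof (rule complex_eqI)
    \<comment> \<open>Replacing \<open>x\<close> by \<open>\<i> *\<^sub>C x\<close> turns the real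
      part into minus the imaginary part, on both sides.\<close>
    show "Im (F x) = Im (cinner x w)"
      using Re_eq[of "\<i> *\<^sub>C x"] by (simp add: FC cinner_scaleC_left)
  qed (rule Re_eq)
  then show ?thesis by blast
qed

text \<open>For each \<open>y\<close>, the Riesz theorem represents the functional sending
  \<open>x\<close> to \<open>cinner (T x) y\<close> by a vector \<open>S y\<close>. Uniqueness of
  that vector makes \<open>S\<close> real-linear, and the square of \<open>norm (S x)\<close> is
  \<open>cinner (T (S x)) x\<close>, which bounds \<open>S\<close> by \<open>norm T\<close>.\<close>

lemma adjoint_exists:
  fixes T :: "'a::chilbert_space \<Rightarrow>\<^sub>L 'a"
  assumes T: "clinear_op T"
  shows "\<exists>S :: 'a \<Rightarrow>\<^sub>L 'a. \<forall>x y. cinner (T x) y = cinner x (S y)"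
proof -
  have "\<exists>w. \<forall>x. cinner (T x) y = cinner x w" for y
  proof (rule riesz_representation)
    show "bounded_linear (\<lambda>x. cinner (T x) y)"
      by (rule bounded_linear_compose[OF cinner.bounded_linear_left blinfun.bounded_linear_right])
    show "cinner (T (c *\<^sub>C x)) y = c * cinner (T x) y" for c x
      using T by (simp add: clinear_op_def cinner_scaleC_left)
  qed
  then obtain S where S: "\<And>x y. cinner (T x) y = cinner x (S y)"
    by metis
  have "bounded_linear S"
  proof (rule bounded_linear_intro[where K = "norm T"])
    show "S (x + y) = S x + S y" for x y
      by (rule cinner_eq_rightI) (simp add: S[symmetric] cinner_add_right)
    show "S (r *\<^sub>R x) = r *\<^sub>R S x" for r x
      by (rule cinner_eq_rightI) (simp add: S[symmetric] cinner.scaleR_right)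
    show "norm (S x) \<le> norm x * norm T" for x
    proof -
      have "(norm (S x))\<^sup>2 = Re (cinner (T (S x)) x)"
        by (simp add: S Re_cinner_self)
      also have "\<dots> \<le> norm (T (S x)) * norm x"
        by (rule Re_cinner_le)
      also have "\<dots> \<le> norm T * norm (S x) * norm x"
        by (intro mult_right_mono norm_blinfun) simp
      finally have "norm (S x) * norm (S x) \<le> norm (S x) * (norm x * norm T)"
        by (simp add: power2_eq_square mult_ac)
      then show ?thesis
        by (cases "norm (S x) = 0") (auto simp: mult_le_cancel_left)
    qed
  qed
  then show ?thesis
    using S by (intro exI[of _ "Blinfun S"]) (simp add: bounded_linear_Blinfun_apply)
qed

text \<open>Representing vectors are unique, so exactly one operator fits the definite description
  behind \<open>cadjoint\<close>.\<close>

lemma cinner_cadjoint: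
  fixes T :: "'a::chilbert_space \<Rightarrow>\<^sub>L 'a"
  assumes "clinear_op T"
  shows "cinner (T x) y = cinner x (cadjoint T y)"
proof -
  from adjoint_exists[OF assms]
  obtain S :: "'a \<Rightarrow>\<^sub>L 'a" where S: "\<forall>x y. cinner (T x) y = cinner x (S y)" ..
  have "cadjoint T = S"
    unfolding cadjoint_def
  proof (rule the_equality)
    show "R = S" if "\<forall>x y. cinner (T x) y = cinner x (R y)" for R :: "'a \<Rightarrow>\<^sub>L 'a"
    proof (rule blinfun_eqI, rule cinner_eq_rightI)
      show "cinner x (R y) = cinner x (S y)" for x y
        using that[rule_format, of x y] S[rule_format, of x y] by simp
    qed
  qed (rule S)
  then show ?thesis by (simp add: S)
qed

section \<open>Boundedness of the spectrum\<close>

text \<open>If \<open>cmod z\<close> exceeds \<open>norm T\<close>, then \<open>T - z\<close> is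
  bounded below by the difference, hence injective. The Banach fixed point theorem makes it
  surjective, and the lower bound makes the inverse bounded.\<close>

lemma norm_spectrum_le:
  fixes T :: "'a::chilbert_space \<Rightarrow>\<^sub>L 'a"
  assumes T: "clinear_op T" and z: "z \<in> spectrum T"
  shows "cmod z \<le> norm T"
proof (rule ccontr)
  assume "\<not> cmod z \<le> norm T"
  then have gt: "norm T < cmod z" by simp
  then have z0: "z \<noteq> 0"
    using norm_ge_zero[of T] by fastforce
  define D where "D = (\<lambda>x. T x - z *\<^sub>C x)"
  have D: "bounded_linear D"
    unfolding D_def
    by (intro bounded_linear_sub blinfun.bounded_linear_right scaleC.bounded_linear_right)
  interpret D: bounded_linear D by fact
  have DC: "D (c *\<^sub>C x) = c *\<^sub>C D x" for c x
    using T by (simp add: D_def clinear_op_def scaleC.diff_right scaleC_scaleC mult.commute)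
  have below: "(cmod z - norm T) * norm x \<le> norm (D x)" for x
  proof -
    have "norm (z *\<^sub>C x) - norm (T x) \<le> norm (D x)"
      unfolding D_def by (metis norm_minus_commute norm_triangle_ineq2)
    then show ?thesis
      using norm_blinfun[of T x] by (simp add: norm_scaleC left_diff_distrib)
  qed
  have inj: "x = y" if "D x = D y" for x y
    using below[of "x - y"] gt that by (simp add: D.diff mult_le_0_iff)
  have "\<exists>x. D x = y" for y
  proof -
    \<comment> \<open>The fixed points of \<open>?g\<close> are the solutions of
      \<open>D x = y\<close>, and \<open>?g\<close> contracts by the factor
      \<open>norm T / cmod z\<close>.\<close>
    let ?g = "\<lambda>x. inverse z *\<^sub>C (T x - y)"
    have "\<exists>!x. ?g x = x"
    proof (rule banach_fix_type)
      show "0 \<le> norm T / cmod z" "norm T / cmod z < 1"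
        using gt z0 by (simp_all add: divide_less_eq)
      show "\<forall>u v. dist (?g u) (?g v) \<le> norm T / cmod z * dist u v"
      proof (intro allI)
        fix u v
        have "?g u - ?g v = inverse z *\<^sub>C T (u - v)"
          by (simp add: scaleC.diff_right blinfun.diff_right)
        then have "dist (?g u) (?g v) = norm (T (u - v)) / cmod z"
          by (simp add: dist_norm norm_scaleC norm_inverse divide_inverse mult.commute)
        also have "\<dots> \<le> norm T * norm (u - v) / cmod z"
          by (intro divide_right_mono norm_blinfun) simp
        finally show "dist (?g u) (?g v) \<le> norm T / cmod z * dist u v"
          by (simp add: dist_norm)
      qed
    qed
    then obtain x where "?g x = x" by blast
    then have "z *\<^sub>C x = z *\<^sub>C ?g x" by simp
    also have "\<dots> = T x - y"
      using z0 by (simp add: scaleC_scaleC scaleC_one)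
    finally show ?thesis
      by (intro exI[of _ x]) (simp add: D_def)
  qed
  then obtain S where S: "\<And>y. D (S y) = y" by metis
  have "bounded_linear S"
  proof (rule bounded_linear_intro[where K = "1 / (cmod z - norm T)"])
    show "S (x + y) = S x + S y" for x y
      by (rule inj) (simp add: S D.add)
    show "S (r *\<^sub>R x) = r *\<^sub>R S x" for r x
      by (rule inj) (simp add: S D.scaleR)
    show "norm (S x) \<le> norm x * (1 / (cmod z - norm T))" for x
      using below[of "S x"] gt by (simp add: S field_simps)
  qed
  note ap = bounded_linear_Blinfun_apply[OF this]
  have SC: "S (c *\<^sub>C x) = c *\<^sub>C S x" for c x
    by (rule inj) (simp add: S DC)
  have "S (D x) = x" for x
    by (rule inj) (simp add: S)
  then have "z \<notin> spectrum T"
    using S SC unfolding spectrum_def D_def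
    by (auto simp: clinear_op_def ap intro!: exI[of _ "Blinfun S"])
  with z show False by simp
qed

section \<open>The scalar measures of a projection-valued measure\<close>

locale pvm =
  fixes M :: "complex measure" and E :: "complex set \<Rightarrow> ('a::chilbert_space \<Rightarrow>\<^sub>L 'a)"
  assumes pvm: "projection_valued_measure M E"
begin

abbreviation \<mu> :: "'a \<Rightarrow> complex measure" where "\<mu> \<equiv> scalar_measure M E"

lemma orth_projection_E: "B \<in> sets M \<Longrightarrow> orth_projection (E B)"
  and E_empty: "E {} = 0"
  and E_space: "E (space M) = id_blinfun"
  and E_Int: "B \<in> sets M \<Longrightarrow> C \<in> sets M \<Longrightarrow> E (B \<inter> C) = E B o\<^sub>L E C"
  and E_sums: "range F \<subseteq> sets M \<Longrightarrow> disjoint_family F \<Longrightarrow> (\<lambda>n. E (F n) x) sums E (\<Union>n. F n) x"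
  using pvm unfolding projection_valued_measure_def by auto

lemma clinear_op_E: "B \<in> sets M \<Longrightarrow> clinear_op (E B)"
  using orth_projection_E by (simp add: orth_projection_def)

lemma E_scaleC: "B \<in> sets M \<Longrightarrow> E B (c *\<^sub>C x) = c *\<^sub>C E B x"
  using clinear_op_E by (simp add: clinear_op_def)

lemma cinner_E_left: "B \<in> sets M \<Longrightarrow> cinner (E B x) y = cinner x (E B y)"
  using cinner_cadjoint[OF clinear_op_E, of B x y] orth_projection_E[of B]
  by (simp add: orth_projection_def)

lemma E_E: "B \<in> sets M \<Longrightarrow> C \<in> sets M \<Longrightarrow> E B (E C x) = E (B \<inter> C) x"
  by (simp add: E_Int)

text \<open>Since \<open>E B\<close> is idempotent and self-adjoint, the value that
  \<open>scalar_measure\<close> prescribes on \<open>B\<close> is a squared norm, in particular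
  nonnegative.\<close>

lemma cinner_E_self: "B \<in> sets M \<Longrightarrow> cinner (E B x) x = complex_of_real ((norm (E B x))\<^sup>2)"
  using E_E[of B B x] cinner_E_left[of B "E B x" x] cinner_self[of "E B x"] by simp

lemma orthogonal_E:
  assumes "B \<in> sets M" "C \<in> sets M" "B \<inter> C = {}"
  shows "cinner (E B x) (E C y) = 0"
proof -
  have "cinner (E B x) (E C y) = cinner (E C (E B x)) y"
    using assms(2) by (simp add: cinner_E_left)
  also have "E C (E B x) = 0"
    using assms by (simp add: E_E Int_commute E_empty)
  finally show ?thesis by (simp add: cinner.zero_left)
qed

lemma space_scalar [simp]: "space (\<mu> x) = space M"
  and sets_scalar [simp, measurable_cong]: "sets (\<mu> x) = sets M"
  unfolding scalar_measure_def by (simp_all add: sets.space_closed sets.sigma_sets_eq)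

text \<open>\<open>measure_of\<close> is only known to take the prescribed values once these are
  countably additive. That is the strong additivity of \<open>E\<close>, sent through the continuous
  real-linear map from \<open>y\<close> to \<open>Re (cinner y x)\<close>.\<close>

lemma emeasure_scalar:
  assumes B: "B \<in> sets M"
  shows "emeasure (\<mu> x) B = ennreal ((norm (E B x))\<^sup>2)"
proof -
  have "emeasure (\<mu> x) B = ennreal (Re (cinner (E B x) x))"
    unfolding scalar_measure_def
  proof (rule emeasure_measure_of_sigma[OF _ _ _ B])
    show "sigma_algebra (space M) (sets M)" ..
    show "positive (sets M) (\<lambda>B. ennreal (Re (cinner (E B x) x)))"
      by (simp add: positive_def E_empty cinner.zero_left)
    show "countably_additive (sets M) (\<lambda>B. ennreal (Re (cinner (E B x) x)))"
    proof (rule countably_additiveI)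
      fix F :: "nat \<Rightarrow> complex set"
      assume F: "range F \<subseteq> sets M" "disjoint_family F"
      have "(\<lambda>n. Re (cinner (E (F n) x) x)) sums Re (cinner (E (\<Union>n. F n) x) x)"
        by (intro bounded_linear.sums[OF bounded_linear_Re]
            bounded_linear.sums[OF cinner.bounded_linear_left] E_sums F)
      moreover have "0 \<le> Re (cinner (E (F n) x) x)" for n
        using F(1) by (auto simp: cinner_E_self simp del: of_real_power)
      ultimately show "(\<Sum>n. ennreal (Re (cinner (E (F n) x) x))) =
          ennreal (Re (cinner (E (\<Union>(range F)) x) x))"
        by (simp add: suminf_ennreal2 sums_iff)
    qed
  qed
  then show ?thesis
    using B by (simp add: cinner_E_self del: of_real_power)
qed

lemma measure_scalar: "B \<in> sets M \<Longrightarrow> measure (\<mu> x) B = (norm (E B x))\<^sup>2"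
  by (simp add: measure_def emeasure_scalar)

lemma finite_measure_scalar: "finite_measure (\<mu> x)"
  by (rule finite_measureI) (simp add: emeasure_scalar)

lemma measure_scalar_space: "measure (\<mu> x) (space M) = (norm x)\<^sup>2"
  by (simp add: measure_scalar E_space)

lemma integrable_scalar:
  fixes g :: "complex \<Rightarrow> 'b::{banach,second_countable_topology}"
  assumes "g \<in> borel_measurable M" "\<And>z. z \<in> space M \<Longrightarrow> norm (g z) \<le> C"
  shows "integrable (\<mu> x) g"
  using assms
  by (intro finite_measure.integrable_const_bound[OF finite_measure_scalar, where B = C] AE_I2)
    (auto cong: measurable_cong_sets)

lemma integral_indicator_scalar:
  fixes c :: "'b::{banach,second_countable_topology}"
  assumes "B \<in> sets M"
  shows "(\<integral>z. indicator B z *\<^sub>R c \<partial>\<mu> x) = (norm (E B x))\<^sup>2 *\<^sub>R c"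
proof -
  have B: "B \<in> sets (\<mu> x)" "B \<inter> space (\<mu> x) = B" "emeasure (\<mu> x) B < \<infinity>"
    using assms sets.sets_into_space[OF assms] by (auto simp: emeasure_scalar)
  then have "integrable (\<mu> x) (indicator B :: complex \<Rightarrow> real)"
    by (intro integrable_real_indicator)
  then show ?thesis
    using assms B(2) by (simp add: measure_scalar)
qed

section \<open>Construction of the spectral integral\<close>

text \<open>A spectral integral together with the two properties that survive passage to the limit.\<close>

definition spectral_rep :: "(complex \<Rightarrow> complex) \<Rightarrow> ('a \<Rightarrow>\<^sub>L 'a) \<Rightarrow> bool" where
  "spectral_rep g T \<longleftrightarrow> has_spectral_integral M E g T \<and>
     (\<forall>x. (norm (T x))\<^sup>2 = (\<integral>z. (cmod (g z))\<^sup>2 \<partial>\<mu> x)) \<and>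
     (\<forall>B\<in>sets M. T o\<^sub>L E B = E B o\<^sub>L T)"

text \<open>The function \<open>h\<close> is left free to serve twice: the identity gives the
  quadratic form of the operator, the squared modulus gives its norm.\<close>

lemma integral_simple_scalar:
  fixes h :: "complex \<Rightarrow> 'b::{banach,second_countable_topology}"
  assumes s: "simple_function M s"
  shows "(\<integral>z. h (s z) \<partial>\<mu> x) =
    (\<Sum>y\<in>s ` space M. (norm (E (s -` {y} \<inter> space M) x))\<^sup>2 *\<^sub>R h y)"
proof -
  interpret finite_measure "\<mu> x" by (rule finite_measure_scalar)
  have fin: "finite (s ` space M)" and meas: "\<And>y. s -` {y} \<inter> space M \<in> sets M"
    using s by (auto simp: simple_functionD)
  have "(\<integral>z. h (s z) \<partial>\<mu> x) =
      (\<integral>z. (\<Sum>y\<in>s ` space M. indicator (s -` {y} \<inter> space M) z *\<^sub>R h y) \<partial>\<mu> x)"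
  proof (rule Bochner_Integration.integral_cong[OF refl])
    fix z assume z: "z \<in> space (\<mu> x)"
    have "(\<Sum>y\<in>s ` space M. indicator (s -` {y} \<inter> space M) z *\<^sub>R h y) =
        (\<Sum>y\<in>s ` space M. if y = s z then h y else 0)"
      using z by (intro sum.cong) (auto simp: indicator_def)
    then show "h (s z) = (\<Sum>y\<in>s ` space M. indicator (s -` {y} \<inter> space M) z *\<^sub>R h y)"
      using fin z by (simp add: sum.delta)
  qed
  also have "\<dots> = (\<Sum>y\<in>s ` space M. (\<integral>z. indicator (s -` {y} \<inter> space M) z *\<^sub>R h y \<partial>\<mu> x))"
    using meas
    by (intro Bochner_Integration.integral_sum)
       (auto intro!: integrable_scaleR_left integrable_real_indicator simp: less_top[symmetric])
  also have "\<dots> = (\<Sum>y\<in>s ` space M. (norm (E (s -` {y} \<inter> space M) x))\<^sup>2 *\<^sub>R h y)"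
    using meas by (intro sum.cong refl integral_indicator_scalar)
  finally show ?thesis .
qed

text \<open>The operator is the sum of \<open>y *\<^sub>C E (B y)\<close> over the values
  \<open>y\<close> of \<open>s\<close>. Distinct level sets \<open>B y\<close> are disjoint, so the
  summands are orthogonal and Pythagoras gives the norm; commutation with \<open>E C\<close>
  reflects the symmetry of intersection.\<close>

lemma spectral_rep_simple:
  assumes s: "simple_function M s"
  shows "\<exists>T. spectral_rep s T"
proof -
  define B where "B y = s -` {y} \<inter> space M" for y
  define I where "I = s ` space M"
  have fin: "finite I" and B: "\<And>y. B y \<in> sets M"
    using s by (auto simp: simple_functionD I_def B_def)
  define t where "t = (\<lambda>x. \<Sum>y\<in>I. y *\<^sub>C E (B y) x)"
  have "bounded_linear t"
    unfolding t_def
    by (intro bounded_linear_sum bounded_linear_compose[OF scaleC.bounded_linear_right]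
        blinfun.bounded_linear_right)
  then have ap: "blinfun_apply (Blinfun t) = t"
    by (rule bounded_linear_Blinfun_apply)
  have "clinear_op (Blinfun t)"
    using B unfolding clinear_op_def ap
    by (simp add: t_def E_scaleC scaleC.sum_right scaleC_scaleC mult.commute)
  moreover have "cinner (t x) x = (\<integral>z. s z \<partial>\<mu> x)" for x
    unfolding t_def cinner.sum_left using integral_simple_scalar[OF s, where h = "\<lambda>y. y" and x = x]
    by (auto simp: cinner_scaleC_left cinner_E_self B B_def[symmetric] I_def[symmetric]
        scaleR_conv_of_real mult.commute intro!: sum.cong)
  moreover have "(norm (t x))\<^sup>2 = (\<integral>z. (cmod (s z))\<^sup>2 \<partial>\<mu> x)" for x
  proof -
    have "(norm (t x))\<^sup>2 = (\<Sum>y\<in>I. (norm (y *\<^sub>C E (B y) x))\<^sup>2)"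
      unfolding t_def
    proof (rule norm_sum_orthogonal_sq[OF fin])
      fix y y' :: complex assume "y \<noteq> y'"
      then have "cinner (E (B y) x) (E (B y') x) = 0"
        by (intro orthogonal_E B) (auto simp: B_def)
      then show "cinner (y *\<^sub>C E (B y) x) (y' *\<^sub>C E (B y') x) = 0"
        by (simp add: cinner_scaleC_left cinner_scaleC_right)
    qed
    also have "\<dots> = (\<integral>z. (cmod (s z))\<^sup>2 \<partial>\<mu> x)"
      using integral_simple_scalar[OF s, where h = "\<lambda>y. (cmod y)\<^sup>2" and x = x]
      by (simp add: norm_scaleC power_mult_distrib B_def[symmetric] I_def[symmetric] mult.commute)
    finally show ?thesis .
  qed
  moreover have "Blinfun t o\<^sub>L E C = E C o\<^sub>L Blinfun t" if "C \<in> sets M" for C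
  proof (rule blinfun_eqI)
    show "(Blinfun t o\<^sub>L E C) x = (E C o\<^sub>L Blinfun t) x" for x
      unfolding blinfun_apply_blinfun_compose ap
      using that B by (simp add: t_def blinfun.sum_right E_scaleC E_E Int_commute)
  qed
  ultimately show ?thesis
    by (intro exI[of _ "Blinfun t"]) (simp add: spectral_rep_def has_spectral_integral_def ap)
qed

text \<open>The bound concerns \<open>space M\<close> alone, because values elsewhere do not enter
  the integrals.\<close>

definition bounded_borel :: "(complex \<Rightarrow> complex) \<Rightarrow> bool" where
  "bounded_borel g \<longleftrightarrow> g \<in> borel_measurable M \<and> (\<exists>C. \<forall>z\<in>space M. cmod (g z) \<le> C)"

lemma bounded_borel_diff:
  assumes "bounded_borel g" "bounded_borel h"
  shows "bounded_borel (\<lambda>z. g z - h z)"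
proof -
  obtain C D where "\<forall>z\<in>space M. cmod (g z) \<le> C" "\<forall>z\<in>space M. cmod (h z) \<le> D"
    using assms by (auto simp: bounded_borel_def)
  then have "\<forall>z\<in>space M. cmod (g z - h z) \<le> C + D"
    by (meson add_mono norm_triangle_ineq4 order_trans)
  then show ?thesis
    using assms by (auto simp: bounded_borel_def)
qed

lemma bounded_borel_simple:
  assumes "simple_function M s"
  shows "bounded_borel s"
proof -
  have "finite ((\<lambda>z. cmod (s z)) ` space M)"
    using simple_functionD(1)[OF assms] by (simp add: image_image[symmetric])
  then have "\<forall>z\<in>space M. cmod (s z) \<le> Max ((\<lambda>z. cmod (s z)) ` space M)"
    by simp
  then show ?thesis
    using borel_measurable_simple_function[OF assms] by (auto simp: bounded_borel_def)
qed

lemma integrable_bounded_borel: "bounded_borel g \<Longrightarrow> integrable (\<mu> x) g"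
  using integrable_scalar by (auto simp: bounded_borel_def)

lemma has_spectral_integral_diff:
  assumes "has_spectral_integral M E g S" "has_spectral_integral M E h T"
    and "bounded_borel g" "bounded_borel h"
  shows "has_spectral_integral M E (\<lambda>z. g z - h z) (S - T)"
  using assms integrable_bounded_borel
  by (simp add: has_spectral_integral_def clinear_op_def blinfun.diff_left cinner.diff_left
      scaleC.diff_right)

text \<open>Uniqueness identifies \<open>D\<close> with \<open>S - T\<close>, and the isometry for
  \<open>D\<close> is the claim. With \<open>D\<close> as a hypothesis the lemma already applies to
  simple functions, before integrals of general bounded functions are known to exist.\<close>

lemma norm_spectral_rep_diff:
  assumes S: "spectral_rep g S" and T: "spectral_rep h T" and D: "spectral_rep (\<lambda>z. g z - h z) D"
    and bdd: "bounded_borel g" "bounded_borel h"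
  shows "(norm (S x - T x))\<^sup>2 = (\<integral>z. (cmod (g z - h z))\<^sup>2 \<partial>\<mu> x)"
proof -
  have "D = S - T"
    using S T D bdd unfolding spectral_rep_def
    by (blast intro: has_spectral_integral_unique has_spectral_integral_diff)
  then show ?thesis
    using D by (simp add: spectral_rep_def blinfun.diff_left)
qed

text \<open>Dominated convergence; the constant \<open>C\<close> is an integrable majorant because
  the scalar measures are finite.\<close>

lemma tendsto_integral_scalar:
  fixes h :: "nat \<Rightarrow> complex \<Rightarrow> 'b::{banach,second_countable_topology}"
  assumes "\<And>n. h n \<in> borel_measurable M" "g \<in> borel_measurable M"
    and "\<And>z. z \<in> space M \<Longrightarrow> (\<lambda>n. h n z) \<longlonglongrightarrow> g z"
    and "\<And>n z. z \<in> space M \<Longrightarrow> norm (h n z) \<le> C"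
  shows "(\<lambda>n. \<integral>z. h n z \<partial>\<mu> x) \<longlonglongrightarrow> (\<integral>z. g z \<partial>\<mu> x)"
proof (rule integral_dominated_convergence[where w = "\<lambda>_. C"])
  show "integrable (\<mu> x) (\<lambda>_. C)"
    using finite_measure.integrable_const[OF finite_measure_scalar] .
qed (use assms in \<open>auto cong: measurable_cong_sets\<close>)

lemma tendsto_integral_diff_sq:
  assumes h: "\<And>n. h n \<in> borel_measurable M" and g: "g \<in> borel_measurable M"
    and lim: "\<And>z. z \<in> space M \<Longrightarrow> (\<lambda>n. h n z) \<longlonglongrightarrow> g z"
    and bdd: "\<And>n z. z \<in> space M \<Longrightarrow> cmod (h n z) \<le> C"
      "\<And>z. z \<in> space M \<Longrightarrow> cmod (g z) \<le> C"
  shows "(\<lambda>n. \<integral>z. (cmod (h n z - g z))\<^sup>2 \<partial>\<mu> x) \<longlonglongrightarrow> 0"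
proof -
  have "(\<lambda>n. \<integral>z. (cmod (h n z - g z))\<^sup>2 \<partial>\<mu> x) \<longlonglongrightarrow> (\<integral>z. 0 \<partial>\<mu> x)"
  proof (rule tendsto_integral_scalar)
    show "(\<lambda>n. (cmod (h n z - g z))\<^sup>2) \<longlonglongrightarrow> 0" if "z \<in> space M" for z
      using tendsto_power[OF tendsto_norm_zero[OF LIM_zero[OF lim[OF that]]], of 2] by simp
    show "norm ((cmod (h n z - g z))\<^sup>2) \<le> (C + C)\<^sup>2" if "z \<in> space M" for n z
      using order_trans[OF norm_triangle_ineq4 add_mono[OF bdd(1) bdd(2)], OF that that]
      unfolding real_norm_def abs_power2 by (rule power_mono) simp
  qed (use h g in measurable)
  then show ?thesis by simp
qed

text \<open>By the isometry, the operators of simple functions converging to \<open>g\<close> form a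
  Cauchy sequence at every vector. All defining properties pass to the pointwise limit
  \<open>t\<close>.\<close>

lemma spectral_rep_exists:
  assumes g: "bounded_borel g"
  shows "\<exists>T. spectral_rep g T"
proof -
  obtain C where C: "\<And>z. z \<in> space M \<Longrightarrow> cmod (g z) \<le> C"
    using g by (auto simp: bounded_borel_def)
  have gm: "g \<in> borel_measurable M"
    using g by (simp add: bounded_borel_def)
  \<comment> \<open>The approximation is taken relative to the point 0, where the distance bound
    becomes \<open>2 * cmod (g z)\<close>; this keeps all \<open>s i\<close> below
    \<open>2 * C\<close>.\<close>
  obtain s where s: "\<And>i. simple_function M (s i)"
      and lim: "\<And>z. z \<in> space M \<Longrightarrow> (\<lambda>i. s i z) \<longlonglongrightarrow> g z"
      and le: "\<And>i z. z \<in> space M \<Longrightarrow> cmod (s i z) \<le> 2 * cmod (g z)"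
    using borel_measurable_implies_sequence_metric[OF gm, of 0] by simp metis
  have sC: "cmod (s i z) \<le> 2 * C" if "z \<in> space M" for i z
    using le[OF that, of i] C[OF that] by linarith
  have gC: "cmod (g z) \<le> 2 * C" if "z \<in> space M" for z
    using C[OF that] norm_ge_zero[of "g z"] by linarith
  have sm: "s i \<in> borel_measurable M" for i
    using s by (rule borel_measurable_simple_function)
  obtain T where T: "\<And>i. spectral_rep (s i) (T i)"
    using spectral_rep_simple[OF s] by metis
  define a where "a = (\<lambda>n x. \<integral>z. (cmod (s n z - g z))\<^sup>2 \<partial>\<mu> x)"
  have a0: "(\<lambda>n. a n x) \<longlonglongrightarrow> 0" for x
    unfolding a_def by (rule tendsto_integral_diff_sq[OF sm gm lim sC gC])
  \<comment> \<open>The difference \<open>s m - s n\<close> is again simple, so its isometry is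
    available. Inserting \<open>g\<close> and using
    \<open>(u + v)\<^sup>2 \<le> 2 * u\<^sup>2 + 2 * v\<^sup>2\<close> reduces it to the distances
    from \<open>g\<close>.\<close>
  have near: "(norm (T m x - T n x))\<^sup>2 \<le> 2 * a m x + 2 * a n x" for m n x
  proof -
    have bd: "(cmod (u - v))\<^sup>2 \<le> (4 * C)\<^sup>2" if "cmod u \<le> 2 * C" "cmod v \<le> 2 * C" for u v
      using norm_triangle_ineq4[of u v] that by (intro power_mono) auto
    have int: "integrable (\<mu> x) (\<lambda>z. (cmod (s n z - g z))\<^sup>2)" for n
      by (rule integrable_scalar[where C = "(4 * C)\<^sup>2"]) (use sm gm sC gC bd in auto)
    have "simple_function M (\<lambda>z. s m z - s n z)"
      by (intro simple_function_diff s)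
    then obtain D where "spectral_rep (\<lambda>z. s m z - s n z) D"
      using spectral_rep_simple by blast
    then have "(norm (T m x - T n x))\<^sup>2 = (\<integral>z. (cmod (s m z - s n z))\<^sup>2 \<partial>\<mu> x)"
      by (intro norm_spectral_rep_diff[OF T T] bounded_borel_simple s)
    also have "\<dots> \<le> (\<integral>z. 2 * (cmod (s m z - g z))\<^sup>2 + 2 * (cmod (s n z - g z))\<^sup>2 \<partial>\<mu> x)"
    proof (rule integral_mono)
      show "integrable (\<mu> x) (\<lambda>z. (cmod (s m z - s n z))\<^sup>2)"
        by (rule integrable_scalar[where C = "(4 * C)\<^sup>2"]) (use sm sC bd in auto)
      show "integrable (\<mu> x) (\<lambda>z. 2 * (cmod (s m z - g z))\<^sup>2 + 2 * (cmod (s n z - g z))\<^sup>2)"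
        using int by simp
      fix z
      have "cmod (s m z - s n z) \<le> cmod (s m z - g z) + cmod (s n z - g z)"
        using norm_triangle_ineq4[of "s m z - g z" "s n z - g z"] by simp
      then have "(cmod (s m z - s n z))\<^sup>2 \<le> (cmod (s m z - g z) + cmod (s n z - g z))\<^sup>2"
        by (simp add: power_mono)
      also have "\<dots> \<le> 2 * (cmod (s m z - g z))\<^sup>2 + 2 * (cmod (s n z - g z))\<^sup>2"
        using sum_squares_bound[of "cmod (s m z - g z)" "cmod (s n z - g z)"]
        by (simp add: power2_sum)
      finally show "(cmod (s m z - s n z))\<^sup>2 \<le>
          2 * (cmod (s m z - g z))\<^sup>2 + 2 * (cmod (s n z - g z))\<^sup>2" .
    qed
    also have "\<dots> = 2 * a m x + 2 * a n x"
      using int by (simp add: a_def)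
    finally show ?thesis .
  qed
  have "Cauchy (\<lambda>n. T n x)" for x
  proof (rule metric_CauchyI)
    fix e :: real assume e: "e > 0"
    then obtain N where N: "\<And>n. n \<ge> N \<Longrightarrow> norm (a n x - 0) < e\<^sup>2 / 4"
      using LIMSEQ_D[OF a0[of x], of "e\<^sup>2 / 4"] by auto
    have "dist (T m x) (T n x) < e" if "m \<ge> N" "n \<ge> N" for m n
    proof -
      have "(norm (T m x - T n x))\<^sup>2 < e\<^sup>2"
        using near[of m x n] N[OF that(1)] N[OF that(2)] by auto
      then show ?thesis
        using e by (simp add: dist_norm power2_less_imp_less)
    qed
    then show "\<exists>N. \<forall>m\<ge>N. \<forall>n\<ge>N. dist (T m x) (T n x) < e" by blast
  qed
  then have "\<exists>y. (\<lambda>n. T n x) \<longlonglongrightarrow> y" for x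
    using Cauchy_convergent convergent_def by blast
  then obtain t where t: "\<And>x. (\<lambda>n. T n x) \<longlonglongrightarrow> t x"
    by metis
  have t_norm: "(norm (t x))\<^sup>2 = (\<integral>z. (cmod (g z))\<^sup>2 \<partial>\<mu> x)" for x
  proof (rule LIMSEQ_unique)
    show "(\<lambda>n. (norm (T n x))\<^sup>2) \<longlonglongrightarrow> (norm (t x))\<^sup>2"
      by (intro tendsto_intros t)
    have "(\<lambda>n. \<integral>z. (cmod (s n z))\<^sup>2 \<partial>\<mu> x) \<longlonglongrightarrow> (\<integral>z. (cmod (g z))\<^sup>2 \<partial>\<mu> x)"
    proof (rule tendsto_integral_scalar[where C = "(2 * C)\<^sup>2"])
      show "norm ((cmod (s n z))\<^sup>2) \<le> (2 * C)\<^sup>2" if "z \<in> space M" for n z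
        unfolding real_norm_def abs_power2 using sC[OF that] by (rule power_mono) simp
    qed (use sm gm lim in \<open>auto intro!: tendsto_intros\<close>)
    then show "(\<lambda>n. (norm (T n x))\<^sup>2) \<longlonglongrightarrow> (\<integral>z. (cmod (g z))\<^sup>2 \<partial>\<mu> x)"
      using T by (simp add: spectral_rep_def)
  qed
  have T_scaleC: "T n (c *\<^sub>C x) = c *\<^sub>C T n x" for n c x
    using T[of n] by (simp add: spectral_rep_def has_spectral_integral_def clinear_op_def)
  have t_scaleC: "t (c *\<^sub>C x) = c *\<^sub>C t x" for c x
    by (rule LIMSEQ_unique[OF t]) (simp add: T_scaleC scaleC.tendsto t)
  have "bounded_linear t"
  \<comment> \<open>The absolute value covers a negative \<open>C\<close>, which is possible when
    \<open>space M\<close> is empty.\<close>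
  proof (rule bounded_linear_intro[where K = "\<bar>C\<bar>"])
    show "t (x + y) = t x + t y" for x y
      by (rule LIMSEQ_unique[OF t]) (simp add: blinfun.add_right tendsto_add t)
    show "t (r *\<^sub>R x) = r *\<^sub>R t x" for r x
      by (rule LIMSEQ_unique[OF t]) (simp add: blinfun.scaleR_right tendsto_scaleR t)
    show "norm (t x) \<le> norm x * \<bar>C\<bar>" for x
    proof (rule power2_le_imp_le)
      have "(\<integral>z. (cmod (g z))\<^sup>2 \<partial>\<mu> x) \<le> (\<integral>z. C\<^sup>2 \<partial>\<mu> x)"
      proof (rule integral_mono)
        show "integrable (\<mu> x) (\<lambda>z. (cmod (g z))\<^sup>2)"
          by (rule integrable_scalar[where C = "C\<^sup>2"]) (use gm C in \<open>auto intro: power_mono\<close>)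
        show "integrable (\<mu> x) (\<lambda>z. C\<^sup>2)"
          by (rule finite_measure.integrable_const[OF finite_measure_scalar])
      qed (use C in \<open>auto intro: power_mono\<close>)
      then show "(norm (t x))\<^sup>2 \<le> (norm x * \<bar>C\<bar>)\<^sup>2"
        by (simp add: t_norm measure_scalar_space power_mult_distrib mult.commute)
    qed simp
  qed
  then have ap: "blinfun_apply (Blinfun t) = t"
    by (rule bounded_linear_Blinfun_apply)
  have "cinner (t x) x = (\<integral>z. g z \<partial>\<mu> x)" for x
  proof (rule LIMSEQ_unique)
    show "(\<lambda>n. cinner (T n x) x) \<longlonglongrightarrow> cinner (t x) x"
      by (intro cinner.tendsto t tendsto_const)
    have "(\<lambda>n. \<integral>z. s n z \<partial>\<mu> x) \<longlonglongrightarrow> (\<integral>z. g z \<partial>\<mu> x)"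
      by (rule tendsto_integral_scalar[OF sm gm lim sC])
    then show "(\<lambda>n. cinner (T n x) x) \<longlonglongrightarrow> (\<integral>z. g z \<partial>\<mu> x)"
      using T by (simp add: spectral_rep_def has_spectral_integral_def)
  qed
  moreover have "Blinfun t o\<^sub>L E B = E B o\<^sub>L Blinfun t" if "B \<in> sets M" for B
  proof (rule blinfun_eqI)
    fix x
    have "T n (E B x) = E B (T n x)" for n
      using T[of n] that unfolding spectral_rep_def by (metis blinfun_apply_blinfun_compose)
    then have "t (E B x) = E B (t x)"
      by (intro LIMSEQ_unique[OF t]) (simp add: blinfun.tendsto t)
    then show "(Blinfun t o\<^sub>L E B) x = (E B o\<^sub>L Blinfun t) x"
      by (simp add: ap)
  qed
  ultimately show ?thesis
    using t_norm t_scaleC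
    by (intro exI[of _ "Blinfun t"])
       (simp add: spectral_rep_def has_spectral_integral_def clinear_op_def ap)
qed

section \<open>Strong convergence of spectral integrals, and indicator functions\<close>

lemma spectral_integral_eq:
  "has_spectral_integral M E g T \<Longrightarrow> spectral_integral M E g = T"
  unfolding spectral_integral_def by (blast intro: has_spectral_integral_unique)

lemma spectral_rep_spectral_integral:
  assumes "bounded_borel g"
  shows "spectral_rep g (spectral_integral M E g)"
proof -
  obtain T where "spectral_rep g T"
    using spectral_rep_exists[OF assms] by blast
  moreover from this have "spectral_integral M E g = T"
    by (intro spectral_integral_eq) (simp add: spectral_rep_def)
  ultimately show ?thesis by simp
qed

text \<open>The isometry for \<open>h n - g\<close> expresses the squared distance at
  \<open>x\<close> as an integral, which tends to 0 by dominated convergence.\<close>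

lemma tendsto_spectral_integral:
  assumes h: "\<And>n. h n \<in> borel_measurable M" and g: "g \<in> borel_measurable M"
    and lim: "\<And>z. z \<in> space M \<Longrightarrow> (\<lambda>n. h n z) \<longlonglongrightarrow> g z"
    and hC: "\<And>n z. z \<in> space M \<Longrightarrow> cmod (h n z) \<le> C"
  shows "(\<lambda>n. spectral_integral M E (h n) x) \<longlonglongrightarrow> spectral_integral M E g x"
proof -
  \<comment> \<open>The uniform bound on the \<open>h n\<close> passes to their pointwise
    limit.\<close>
  have gC: "cmod (g z) \<le> C" if "z \<in> space M" for z
    using LIMSEQ_le_const2[OF tendsto_norm[OF lim[OF that]]] hC[OF that] by blast
  have bdd: "bounded_borel (h n)" "bounded_borel g" for n
    unfolding bounded_borel_def using h g hC gC by blast+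
  have "(norm (spectral_integral M E (h n) x - spectral_integral M E g x))\<^sup>2 =
      (\<integral>z. (cmod (h n z - g z))\<^sup>2 \<partial>\<mu> x)" for n
    by (rule norm_spectral_rep_diff[where D = "spectral_integral M E (\<lambda>z. h n z - g z)"])
       (intro spectral_rep_spectral_integral bounded_borel_diff bdd)+
  then have "(\<lambda>n. (norm (spectral_integral M E (h n) x - spectral_integral M E g x))\<^sup>2) \<longlonglongrightarrow> 0"
    using tendsto_integral_diff_sq[OF h g lim hC gC] by simp
  then have "(\<lambda>n. sqrt ((norm (spectral_integral M E (h n) x - spectral_integral M E g x))\<^sup>2))
      \<longlonglongrightarrow> sqrt 0"
    by (rule tendsto_real_sqrt)
  then show ?thesis
    by (simp add: LIM_zero_iff tendsto_norm_zero_iff)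
qed

lemma has_spectral_integral_indicator:
  assumes "B \<in> sets M" and g: "\<And>z. z \<in> space M \<Longrightarrow> g z = indicator B z"
  shows "has_spectral_integral M E g (E B)"
proof -
  have "(\<integral>z. g z \<partial>\<mu> x) = cinner (E B x) x" for x
  proof -
    have "(\<integral>z. g z \<partial>\<mu> x) = (\<integral>z. indicator B z *\<^sub>R 1 \<partial>\<mu> x)"
      by (rule Bochner_Integration.integral_cong) (auto simp: g indicator_def)
    also have "\<dots> = (norm (E B x))\<^sup>2 *\<^sub>R 1"
      by (rule integral_indicator_scalar) fact
    also have "\<dots> = cinner (E B x) x"
      using assms(1) by (simp add: cinner_E_self scaleR_conv_of_real)
    finally show ?thesis .
  qed
  then show ?thesis
    using clinear_op_E assms(1) by (simp add: has_spectral_integral_def)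
qed

end

section \<open>Spectrum of a projection\<close>

text \<open>A nonzero vector in the range is an eigenvector for 1, one in the kernel an eigenvector
  for 0. For every other \<open>z\<close> the resolvent can be written down.\<close>

lemma spectrum_orth_projection:
  fixes P :: "'a::chilbert_space \<Rightarrow>\<^sub>L 'a"
  assumes P: "orth_projection P" and "P \<noteq> 0" "P \<noteq> id_blinfun"
  shows "spectrum P = {0, 1}"
proof -
  have PC: "P (c *\<^sub>C x) = c *\<^sub>C P x" and PP: "P (P x) = P x" for c x
    using P unfolding orth_projection_def clinear_op_def
    by (auto simp flip: blinfun_apply_blinfun_compose)
  have eigen: "z \<in> spectrum P" if "P v = z *\<^sub>C v" "v \<noteq> 0" for z v
  proof (rule ccontr)
    assume "z \<notin> spectrum P"
    then obtain S :: "'a \<Rightarrow>\<^sub>L 'a" where "\<And>x. S (P x - z *\<^sub>C x) = x"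
      unfolding spectrum_def by blast
    from this[of v] that show False by simp
  qed
  obtain x where "P x \<noteq> 0"
    using \<open>P \<noteq> 0\<close> blinfun_eqI[of P 0] by auto
  then have "1 \<in> spectrum P"
    by (intro eigen[of "P x"]) (simp_all add: PP scaleC_one)
  moreover obtain y where "P y \<noteq> y"
    using \<open>P \<noteq> id_blinfun\<close> blinfun_eqI[of P id_blinfun] by auto
  \<comment> \<open>\<open>P y - y\<close> is nonzero and annihilated by \<open>P\<close>.\<close>
  then have "0 \<in> spectrum P"
    by (intro eigen[of "P y - y"]) (simp_all add: PP blinfun.diff_right scaleC.zero_left)
  moreover have "z \<in> {0, 1}" if "z \<in> spectrum P" for z
  proof (rule ccontr)
    assume "z \<notin> {0, 1}"
    then have z: "z \<noteq> 0" "1 - z \<noteq> 0" by auto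
    define a where "a = inverse (1 - z)"
    \<comment> \<open>The resolvent: \<open>P - z\<close> acts as \<open>1 - z\<close> on the range
      of \<open>P\<close> and as \<open>- z\<close> on its kernel, so each component is divided by
      its factor.\<close>
    define t where "t = (\<lambda>x. a *\<^sub>C P x - inverse z *\<^sub>C (x - P x))"
    have "bounded_linear t"
      unfolding t_def
      by (intro bounded_linear_sub bounded_linear_compose[OF scaleC.bounded_linear_right]
          blinfun.bounded_linear_right bounded_linear_ident)
    then have ap: "blinfun_apply (Blinfun t) = t"
      by (rule bounded_linear_Blinfun_apply)
    have "clinear_op (Blinfun t)"
      unfolding clinear_op_def ap
      by (simp add: t_def PC scaleC.diff_right scaleC_scaleC mult.commute)
    moreover have split: "a *\<^sub>C (P x - z *\<^sub>C P x) = P x" for x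
    proof -
      have "P x - z *\<^sub>C P x = (1 - z) *\<^sub>C P x"
        by (simp add: scaleC.diff_left scaleC_one)
      then show ?thesis
        using z by (simp add: scaleC_scaleC a_def scaleC_one)
    qed
    have "t (P x - z *\<^sub>C x) = x" for x
    proof -
      have "P (P x - z *\<^sub>C x) = P x - z *\<^sub>C P x"
        by (simp add: blinfun.diff_right PC PP)
      then have "t (P x - z *\<^sub>C x) = P x - inverse z *\<^sub>C (z *\<^sub>C (P x - x))"
        unfolding t_def by (simp only: split) (simp add: scaleC.diff_right)
      then show ?thesis
        using z by (simp only: scaleC_scaleC) (simp add: scaleC_one)
    qed
    moreover have "P (t x) - z *\<^sub>C t x = x" for x
    proof -
      have "P (t x) = a *\<^sub>C P x"
        by (simp add: t_def blinfun.diff_right PC PP scaleC.zero_right)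
      moreover have "z *\<^sub>C t x = a *\<^sub>C z *\<^sub>C P x - (x - P x)"
        unfolding t_def scaleC.diff_right[of z] scaleC_scaleC
        using z by (simp add: scaleC_one mult.commute)
      ultimately show ?thesis
        using split[of x] by (simp add: scaleC.diff_right diff_eq_eq add.commute)
    qed
    ultimately have "z \<notin> spectrum P"
      unfolding spectrum_def using ap by (auto intro!: exI[of _ "Blinfun t"])
    with that show False by simp
  qed
  ultimately show ?thesis by blast
qed

section \<open>Iterates on the spectrum\<close>

text \<open>Only the stages below \<open>n\<close> are arguments of some \<open>p k\<close>, so
  these must lie in \<open>U\<close>; the final value may leave it.\<close>

lemma continuous_on_comp_chain:
  assumes "\<And>k. k \<in> {1..n} \<Longrightarrow> continuous_on U (p k)"
    and "\<And>k z. k < n \<Longrightarrow> z \<in> V \<Longrightarrow> comp_chain p k z \<in> U"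
  shows "continuous_on V (comp_chain p n)"
  using assms
proof (induction n)
  case 0
  then show ?case by (simp add: id_def)
next
  case (Suc n)
  then have "continuous_on V (comp_chain p n)" by simp
  moreover have "continuous_on (comp_chain p n ` V) (p (Suc n))"
    by (rule continuous_on_subset[of U]) (use Suc.prems in auto)
  ultimately show ?case
    unfolding comp_chain.simps by (rule continuous_on_compose)
qed

text \<open>Applied with the spectrum as \<open>V\<close>, this supplies the measurability of the
  iterates.\<close>

lemma continuous_on_iterate:
  assumes cont: "\<And>k. k \<in> {1..K} \<Longrightarrow> continuous_on U (p k)"
    and "\<And>z. z \<in> V \<Longrightarrow> iterate_defined_at p K U m z"
  shows "continuous_on V (comp_chain p K ^^ m)"
  using assms(2)
proof (induction m)
  case 0
  then show ?case by (simp add: id_def)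
next
  case (Suc m)
  then have "continuous_on V (comp_chain p K ^^ m)"
    by (simp add: iterate_defined_at_def)
  moreover have "continuous_on ((comp_chain p K ^^ m) ` V) (comp_chain p K)"
    using Suc.prems by (intro continuous_on_comp_chain[OF cont]) (auto simp: iterate_defined_at_def)
  ultimately show ?case
    unfolding funpow.simps by (rule continuous_on_compose)
qed

text \<open>Finiteness of the supremum matters here, because \<open>enn2real\<close> sends infinity
  to 0.\<close>

lemma norm_le_of_sup_norm_on:
  assumes "(SUP m. sup_norm_on S (g m)) < \<infinity>" "z \<in> S"
  shows "cmod (g m z) \<le> enn2real (SUP m. sup_norm_on S (g m))"
proof -
  have "ennreal (cmod (g m z)) \<le> sup_norm_on S (g m)"
    unfolding sup_norm_on_def using assms(2) by (rule SUP_upper)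
  also have "\<dots> \<le> (SUP m. sup_norm_on S (g m))"
    by (rule SUP_upper) simp
  finally show ?thesis
    using enn2real_mono[of "ennreal (cmod (g m z))"] assms(1) by simp
qed

text \<open>The strong operator topology is the pullback of the product topology under
  \<open>blinfun_apply\<close>, and convergence in a product is componentwise.\<close>

lemma limitin_strong_operator_topologyI:
  fixes T :: "nat \<Rightarrow> 'a::real_normed_vector \<Rightarrow>\<^sub>L 'b::real_normed_vector"
    and L :: "'a \<Rightarrow>\<^sub>L 'b"
  assumes "\<And>x. (\<lambda>n. T n x) \<longlonglongrightarrow> L x"
  shows "limitin strong_operator_topology T L sequentially"
  unfolding limitin_def
proof (intro conjI allI impI)
  show "L \<in> topspace strong_operator_topology"
    by (simp add: strong_operator_topology_topspace)
  fix W assume "openin strong_operator_topology W \<and> L \<in> W"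
  then obtain X where X: "open X" "W = blinfun_apply -` X" "blinfun_apply L \<in> X"
    by (auto simp: strong_operator_topology_def openin_pullback_topology)
  have "((\<lambda>n. blinfun_apply (T n)) \<longlonglongrightarrow> blinfun_apply L)"
    using assms
    by (simp add: limitin_componentwise flip: limitin_canonical_iff euclidean_product_topology)
  from topological_tendstoD[OF this X(1,3)] show "\<forall>\<^sub>F n in sequentially. T n \<in> W"
    by (simp add: X(2))
qed

section \<open>Strong limit of the iterates and the limiting projection\<close>

theorem theorem2p1:
  fixes A :: "'h::chilbert_space \<Rightarrow>\<^sub>L 'h"
    and E :: "complex set \<Rightarrow> ('h \<Rightarrow>\<^sub>L 'h)"
    and U :: "complex set"
    and p :: "nat \<Rightarrow> complex \<Rightarrow> complex"
    and K :: nat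
    and f chi :: "complex \<Rightarrow> complex"
  assumes "normal_op A"
    and "is_spectral_measure A E"
    and "open U" and "spectrum A \<subseteq> U"
    and "K \<ge> 1"
    and "\<And>k. k \<in> {1..K} \<Longrightarrow> p k holomorphic_on U"
    and "\<And>k. k \<in> {1..K} \<Longrightarrow> sup_norm_on (spectrum A) (p k) \<le> 1"
    and "f = comp_chain p K"
    and "\<And>m. \<exists>V. open V \<and> spectrum A \<subseteq> V \<and> (\<forall>z\<in>V. iterate_defined_at p K U m z)"
    and "(SUP m. sup_norm_on (spectrum A) (f ^^ m)) < \<infinity>"
    and "chi \<in> borel_measurable (restrict_space borel (spectrum A))"
    and "\<And>z. z \<in> spectrum A \<Longrightarrow> (\<lambda>m. (f ^^ m) z) \<longlonglongrightarrow> chi z"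
  shows "(\<exists>A\<omega>. clinear_op A\<omega> \<and>
            limitin strong_operator_topology (\<lambda>m. borel_calculus A E (f ^^ m)) A\<omega> sequentially \<and>
            A\<omega> = borel_calculus A E chi) \<and>
         ((\<forall>z\<in>spectrum A. chi z \<in> {0, 1}) \<longrightarrow>
            (let P = borel_calculus A E chi in
               orth_projection P \<and>
               P o\<^sub>L A = A o\<^sub>L P \<and>
               range (blinfun_apply P) = range (blinfun_apply (E {z \<in> spectrum A. chi z = 1})) \<and>
               (P \<noteq> 0 \<longrightarrow> P \<noteq> id_blinfun \<longrightarrow> spectrum P = {0, 1})))"
proof -
  let ?M = "spectral_space A"
  interpret pvm ?M E
    by unfold_locales (use assms(2) in \<open>simp add: is_spectral_measure_def\<close>)
  have space: "space ?M = spectrum A"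
    by (simp add: spectral_space_def space_restrict_space)
  have A: "clinear_op A" "has_spectral_integral ?M E (\<lambda>z. z) A"
    using assms(1,2) by (simp_all add: normal_op_def is_spectral_measure_def)
  have f_meas: "f ^^ m \<in> borel_measurable ?M" for m
  proof -
    have "continuous_on (spectrum A) (f ^^ m)"
      unfolding assms(8) using assms(9)[of m] assms(6)
      by (intro continuous_on_iterate[of K U]) (auto intro: holomorphic_on_imp_continuous_on)
    then show ?thesis
      unfolding spectral_space_def by (rule borel_measurable_continuous_on_restrict)
  qed
  have chi_meas: "chi \<in> borel_measurable ?M"
    using assms(11) by (simp add: spectral_space_def)
  define C where "C = enn2real (SUP m. sup_norm_on (spectrum A) (f ^^ m))"
  have f_bdd: "cmod ((f ^^ m) z) \<le> C" if "z \<in> space ?M" for m z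
    unfolding C_def using assms(10) that space by (intro norm_le_of_sup_norm_on) auto
  have f_lim: "(\<lambda>m. (f ^^ m) z) \<longlonglongrightarrow> chi z" if "z \<in> space ?M" for z
    using assms(12) that space by simp
  have "cmod (chi z) \<le> C" if "z \<in> space ?M" for z
    using LIMSEQ_le_const2[OF tendsto_norm[OF f_lim[OF that]]] f_bdd[OF that] by auto
  then have "bounded_borel chi"
    using chi_meas by (auto simp: bounded_borel_def)
  then have "clinear_op (borel_calculus A E chi)"
    using spectral_rep_spectral_integral
    by (simp add: borel_calculus_def spectral_rep_def has_spectral_integral_def)
  moreover have "limitin strong_operator_topology (\<lambda>m. borel_calculus A E (f ^^ m))
      (borel_calculus A E chi) sequentially"
    unfolding borel_calculus_def
    by (intro limitin_strong_operator_topologyI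
        tendsto_spectral_integral[OF f_meas chi_meas f_lim f_bdd])
  moreover have "orth_projection P \<and> P o\<^sub>L A = A o\<^sub>L P \<and>
      range (blinfun_apply P) = range (blinfun_apply (E {z \<in> spectrum A. chi z = 1})) \<and>
      (P \<noteq> 0 \<longrightarrow> P \<noteq> id_blinfun \<longrightarrow> spectrum P = {0, 1})"
    if chi01: "\<forall>z\<in>spectrum A. chi z \<in> {0, 1}" and P: "P = borel_calculus A E chi" for P
  proof -
    define B where "B = {z \<in> spectrum A. chi z = 1}"
    have "chi -` {1} \<inter> space ?M \<in> sets ?M"
      by (rule measurable_sets[OF chi_meas]) simp
    also have "chi -` {1} \<inter> space ?M = B"
      by (auto simp: B_def space)
    finally have B: "B \<in> sets ?M" .
    have "has_spectral_integral ?M E chi (E B)"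
      using chi01 by (intro has_spectral_integral_indicator[OF B]) (auto simp: space B_def indicator_def)
    then have PE: "P = E B"
      unfolding P borel_calculus_def by (rule spectral_integral_eq)
    have "(\<lambda>z. z) \<in> borel_measurable ?M"
      by (simp add: spectral_space_def measurable_restrict_space1)
    then have "bounded_borel (\<lambda>z. z)"
      using norm_spectrum_le[OF A(1)] by (auto simp: bounded_borel_def space)
    \<comment> \<open>\<open>spectral_rep\<close> carries commutation with every \<open>E B\<close>;
      uniqueness of the spectral integral of the identity function transfers this from
      \<open>T\<close> to \<open>A\<close>.\<close>
    then obtain T where T: "spectral_rep (\<lambda>z. z) T"
      using spectral_rep_exists by blast
    then have "T = A"
      using A(2) by (auto simp: spectral_rep_def intro: has_spectral_integral_unique)
    with T B have "A o\<^sub>L P = P o\<^sub>L A"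
      by (simp add: spectral_rep_def PE)
    then show ?thesis
      using orth_projection_E[OF B] spectrum_orth_projection[of P]
      by (simp add: PE B_def)
  qed
  ultimately show ?thesis
    by (simp add: Let_def)
qed

end
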